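(* Let $p \in [1,\infty) \cup \{\infty\}$ with $p \neq 2$. Then there are exactly eight isometries $\varphi$ of the metric space $(\mathbb{R}^2, d_p)$ with $\varphi(0,0) = (0,0)$. They are the identity, the reflections across the $y$-axis, the $x$-axis, the line $y = x$ and the line $y = -x$, and the rotations about the origin by $\frac{\pi}{2}$, $\pi$ and $-\frac{\pi}{2}$.
   Context: For $1 \le p < \infty$, the $\ell^p$ metric on $\mathbb{R}^2$ is $d_p((x_1,y_1),(x_2,y_2)) = (|x_2-x_1|^p + |y_2-y_1|^p)^{1/p}$. For $p = \infty$ it is $d_\infty((x_1,y_1),(x_2,y_2)) = \max\{|x_2-x_1|, |y_2-y_1|\}$. An isometry of a metric space $(X,d)$ is a bijective map $\varphi: X \to X$ such that $d(\varphi(x),\varphi(y)) = d(x,y)$ for all $x,y \in X$. No linearity or affineness is assumed. Reflections and rotations are the usual Euclidean reflections and rotations of the plane. *)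

theory Defs
  imports "HOL-Analysis.Analysis"
begin

text \<open>The exponent ranges over \<^typ>\<open>ereal\<close> so that it may take the value \<open>\<infinity>\<close>; only
  \<^prop>\<open>1 \<le> p\<close> is intended.\<close>

definition lp_dist :: "ereal \<Rightarrow> real \<times> real \<Rightarrow> real \<times> real \<Rightarrow> real" where
  "lp_dist p a b =
     (if p = \<infinity> then max \<bar>fst b - fst a\<bar> \<bar>snd b - snd a\<bar>
      else (\<bar>fst b - fst a\<bar> powr real_of_ereal p + \<bar>snd b - snd a\<bar> powr real_of_ereal p)
             powr (1 / real_of_ereal p))"

definition isometry_of :: "'a set \<Rightarrow> ('a \<Rightarrow> 'a \<Rightarrow> real) \<Rightarrow> ('a \<Rightarrow> 'a) \<Rightarrow> bool" where
  "isometry_of X d \<phi> \<longleftrightarrow>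
     bij_betw \<phi> X X \<and> (\<forall>x\<in>X. \<forall>y\<in>X. d (\<phi> x) (\<phi> y) = d x y)"

text \<open>The Euclidean reflection across a line \<open>L\<close>: the foot of the perpendicular from \<open>z\<close> to \<open>L\<close>
  is the midpoint of \<open>z\<close> and its image. The foot is \<^term>\<open>closest_point L z\<close>, which refers to the
  Euclidean metric of \<^typ>\<open>real \<times> real\<close>, not to \<^const>\<open>lp_dist\<close>.\<close>

definition reflection :: "(real \<times> real) set \<Rightarrow> real \<times> real \<Rightarrow> real \<times> real" where
  "reflection L z = 2 *\<^sub>R closest_point L z - z"

text \<open>Anticlockwise rotation about the origin.\<close>

definition rotation :: "real \<Rightarrow> real \<times> real \<Rightarrow> real \<times> real" where
  "rotation t z = (cos t * fst z - sin t * snd z, sin t * fst z + cos t * snd z)"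

end

theory Submission
  imports Defs
begin

text \<open>
  The proof follows Mazur--Ulam and Lamperti.

  An isometry that fixes the origin is linear. By Vaisala's argument it preserves midpoints
  (\<open>quasinorm_isometry_preserves_midpoint\<close>), so it is additive; being bounded on bounded sets, it is
  then homogeneous over the reals (\<open>additive_norm_bounded_imp_linear\<close>). It is therefore determined by the images
  \<open>u\<close> and \<open>v\<close> of the two basis vectors, which have norm one.

  For \<open>2 < p < \<infinity>\<close> one has \<open>\<bar>a + b\<bar>\<^sup>p + \<bar>a - b\<bar>\<^sup>p \<ge> 2 (\<bar>a\<bar>\<^sup>p + \<bar>b\<bar>\<^sup>p)\<close>, for \<open>p < 2\<close> the reverse
  inequality, and in both cases equality forces \<open>a b = 0\<close>. Summed over the coordinates of \<open>u\<close> and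
  \<open>v\<close>, this inequality is an equality, because \<open>u + v\<close> and \<open>u - v\<close> have the norms of \<open>(1, 1)\<close> and
  \<open>(1, -1)\<close>. So \<open>u\<close> and \<open>v\<close> have disjoint supports (\<open>lp_norm_disjoint\<close>, which also treats
  \<open>p = \<infinity>\<close>). Two vectors of norm one in the plane with disjoint supports are
  \<open>(\<plusminus>1, 0)\<close> and \<open>(0, \<plusminus>1)\<close> in some order, which gives eight linear maps, and these are the
  listed reflections and rotations. For \<open>p = 2\<close> the inequality degenerates to the parallelogram law,
  which gives no information on \<open>u\<close> and \<open>v\<close>.
\<close>

section \<open>Isometries are linear\<close>

text \<open>
  Let \<open>z\<close> be the midpoint of \<open>a\<close> and \<open>b\<close>, let \<open>\<psi>\<close> be the point reflection in \<open>z\<close>, and let \<open>W\<close> be the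
  group of isometries fixing \<open>a\<close> and \<open>b\<close>. Every \<open>g \<in> W\<close> fixes \<open>z\<close>: the map \<open>\<psi> g\<^bsup>-1\<^esup> \<psi> g\<close> is again in \<open>W\<close> and
  moves \<open>z\<close> twice as far as \<open>g\<close> does, while the displacements of \<open>z\<close> under \<open>W\<close> are bounded. If \<open>\<psi>'\<close> is
  the point reflection in the midpoint of \<open>f a\<close> and \<open>f b\<close>, then \<open>\<psi> f\<^bsup>-1\<^esup> \<psi>' f\<close> is in \<open>W\<close>, so it fixes \<open>z\<close>;
  this says that \<open>f z\<close> is the fixed point of \<open>\<psi>'\<close>.
\<close>
lemma quasinorm_isometry_preserves_midpoint:
  fixes N :: "'a::real_vector \<Rightarrow> real" and f :: "'a \<Rightarrow> 'a"
  assumes hom: "\<And>r v. N (r *\<^sub>R v) = \<bar>r\<bar> * N v"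
    and definite: "\<And>v. N v = 0 \<Longrightarrow> v = 0"
    and nonneg: "\<And>v. 0 \<le> N v"
    and quasi: "\<And>u v. N (u + v) \<le> C * (N u + N v)"
    and "bij f" and iso: "\<And>x y. N (f x - f y) = N (x - y)"
  shows "f ((1/2) *\<^sub>R (a + b)) = (1/2) *\<^sub>R (f a + f b)"
proof -
  have sym: "N (u - v) = N (v - u)" for u v
    using hom[of "-1" "u - v"] by simp
  define z where "z = (1/2) *\<^sub>R (a + b)"
  define \<psi> where "\<psi> w = (a + b) - w" for w
  have two_z: "a + b = 2 *\<^sub>R z"
    by (simp add: z_def)
  have \<psi>_iso: "N (\<psi> x - \<psi> y) = N (x - y)" for x y
    using sym[of x y] by (simp add: \<psi>_def)
  have \<psi>_\<psi>: "\<psi> (\<psi> w) = w" for w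
    by (simp add: \<psi>_def)
  then have "bij \<psi>"
    by (metis bijI')
  have \<psi>_ab: "\<psi> a = b" "\<psi> b = a"
    by (simp_all add: \<psi>_def)
  have \<psi>_z: "\<psi> z = z"
    unfolding \<psi>_def two_z by (simp add: scaleR_2)
  have \<psi>_move: "N (\<psi> w - w) = 2 * N (w - z)" for w
  proof -
    have "\<psi> w - w = (-2) *\<^sub>R (w - z)"
      unfolding \<psi>_def two_z by (simp add: algebra_simps scaleR_2)
    then show ?thesis
      using hom[of "-2" "w - z"] by simp
  qed
  define W where "W = {g. bij g \<and> (\<forall>x y. N (g x - g y) = N (x - y)) \<and> g a = a \<and> g b = b}"
  have inv_iso: "N (inv g x - inv g y) = N (x - y)"
    if "bij g" "\<And>x y. N (g x - g y) = N (x - y)" for g x y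
    using that(2)[of "inv g x" "inv g y"] that(1) by (simp add: bij_is_surj surj_f_inv_f)
  define D where "D = (SUP g\<in>W. N (g z - z))"
  have bdd: "bdd_above ((\<lambda>g. N (g z - z)) ` W)"
  proof (rule bdd_aboveI2)
    fix g assume "g \<in> W"
    then have "N (g z - a) = N (z - a)"
      unfolding W_def by (metis (mono_tags, lifting) mem_Collect_eq)
    then show "N (g z - z) \<le> C * (N (z - a) + N (a - z))"
      using quasi[of "g z - a" "a - z"] by simp
  qed
  have half: "2 * N (g z - z) \<le> D" if "g \<in> W" for g
  proof -
    have g: "bij g" "\<And>x y. N (g x - g y) = N (x - y)" "g a = a" "g b = b"
      using that by (auto simp: W_def)
    have inv_ab: "inv g a = a" "inv g b = b"
      using g by (metis bij_inv_eq_iff)+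
    define h where "h = \<psi> \<circ> inv g \<circ> \<psi> \<circ> g"
    have "bij h"
      unfolding h_def using g(1) \<open>bij \<psi>\<close> by (intro bij_comp bij_imp_bij_inv)
    moreover have "N (h x - h y) = N (x - y)" for x y
      by (simp add: h_def \<psi>_iso inv_iso[OF g(1,2)] g(2))
    ultimately have "h \<in> W"
      by (simp add: W_def h_def g inv_ab \<psi>_ab)
    have "2 * N (g z - z) = N (\<psi> (g z) - g z)"
      by (simp add: \<psi>_move)
    also have "\<dots> = N (inv g (\<psi> (g z)) - z)"
      using inv_iso[OF g(1,2), of "\<psi> (g z)" "g z"] g(1) by (simp add: bij_is_inj)
    also have "\<dots> = N (h z - z)"
      using \<psi>_iso[of "inv g (\<psi> (g z))" z] by (simp add: h_def \<psi>_z)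
    also have "\<dots> \<le> D"
      unfolding D_def by (rule cSUP_upper[OF \<open>h \<in> W\<close> bdd])
    finally show ?thesis .
  qed
  have "id \<in> W"
    by (simp add: W_def)
  then have "D \<le> D / 2"
    using half unfolding D_def[symmetric]
    by (subst D_def, intro cSUP_least) (auto simp: field_simps)
  have fix_z: "g z = z" if "g \<in> W" for g
    using half[OF that] \<open>D \<le> D / 2\<close> nonneg[of "g z - z"] definite[of "g z - z"] by simp
  define \<psi>' where "\<psi>' w = (f a + f b) - w" for w
  have \<psi>'_iso: "N (\<psi>' x - \<psi>' y) = N (x - y)" for x y
    using sym[of x y] by (simp add: \<psi>'_def)
  have "\<psi>' (\<psi>' w) = w" for w
    by (simp add: \<psi>'_def)
  then have "bij \<psi>'"
    by (metis bijI')
  define h where "h = \<psi> \<circ> inv f \<circ> \<psi>' \<circ> f"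
  have "bij h"
    unfolding h_def using \<open>bij f\<close> \<open>bij \<psi>\<close> \<open>bij \<psi>'\<close> by (intro bij_comp bij_imp_bij_inv)
  moreover have "N (h x - h y) = N (x - y)" for x y
    by (simp add: h_def \<psi>_iso \<psi>'_iso inv_iso[OF \<open>bij f\<close> iso] iso)
  ultimately have "h \<in> W"
    using \<open>bij f\<close> by (simp add: W_def h_def \<psi>_ab \<psi>'_def bij_is_inj)
  then have "\<psi> (inv f (\<psi>' (f z))) = z"
    using fix_z by (force simp: h_def)
  then have "inv f (\<psi>' (f z)) = z"
    by (metis \<psi>_\<psi> \<psi>_z)
  then have "\<psi>' (f z) = f z"
    using \<open>bij f\<close> by (metis bij_inv_eq_iff)
  then have "f a + f b = 2 *\<^sub>R f z"
    by (simp add: \<psi>'_def scaleR_2 algebra_simps)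
  then show ?thesis
    by (simp add: z_def)
qed

lemma midpoint_preserving_imp_additive:
  fixes f :: "'a::real_vector \<Rightarrow> 'b::real_vector"
  assumes mid: "\<And>a b. f ((1/2) *\<^sub>R (a + b)) = (1/2) *\<^sub>R (f a + f b)" and "f 0 = 0"
  shows "f (x + y) = f x + f y"
proof -
  have double: "f (2 *\<^sub>R v) = 2 *\<^sub>R f v" for v
    using mid[of "2 *\<^sub>R v" 0] \<open>f 0 = 0\<close> by simp
  have "f (2 *\<^sub>R ((1/2) *\<^sub>R (x + y))) = 2 *\<^sub>R ((1/2) *\<^sub>R (f x + f y))"
    unfolding double mid ..
  then show ?thesis
    by simp
qed

text \<open>
  For fixed \<open>x\<close>, the defect \<open>h s = f (s x) - s f x\<close> is additive in \<open>s\<close> and vanishes at \<open>1\<close>, hence at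
  every integer. So it has period one and is bounded by its bound on \<open>[0, 1]\<close>; as \<open>h (n r) = n h r\<close>,
  a bounded \<open>h\<close> must be zero.
\<close>
lemma additive_norm_bounded_imp_linear:
  fixes f :: "'a::real_normed_vector \<Rightarrow> 'b::real_normed_vector"
  assumes add: "\<And>x y. f (x + y) = f x + f y" and bound: "\<And>x. norm (f x) \<le> C * norm x"
  shows "linear f"
proof (rule linearI[OF add])
  fix r :: real and x
  define h where "h s = f (s *\<^sub>R x) - s *\<^sub>R f x" for s
  have h_add: "h (s + t) = h s + h t" for s t
    by (simp add: h_def add scaleR_add_left)
  have h0: "h 0 = 0"
    using h_add[of 0 0] by simp
  have h_nat: "h (real n * s) = real n *\<^sub>R h s" for n s
    by (induction n) (simp_all add: h0 h_add algebra_simps)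
  have "h 1 = 0"
    by (simp add: h_def)
  then have h_nat0: "h (real n) = 0" for n
    using h_nat[of n 1] by simp
  have h_int0: "h (of_int m) = 0" for m
  proof (cases m)
    case (nonneg n)
    then show ?thesis using h_nat0 by simp
  next
    case (neg n)
    then show ?thesis using h_nat0[of "Suc n"] h_add[of "of_int m" "real (Suc n)"] h0 by simp
  qed
  have Cx: "0 \<le> C * norm x"
    using bound[of x] norm_ge_zero order_trans by blast
  have "real n * norm (h r) \<le> 2 * (C * norm x)" for n
  proof -
    define s where "s = frac (real n * r)"
    have "h (real n * r) = h s"
      using h_add[of s "of_int \<lfloor>real n * r\<rfloor>"] by (simp add: s_def frac_def h_int0)
    then have "real n * norm (h r) = norm (h s)"
      using h_nat[of n r] by (metis abs_of_nat norm_scaleR)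
    also have "\<dots> \<le> norm (f (s *\<^sub>R x)) + norm (s *\<^sub>R f x)"
      unfolding h_def by (rule norm_triangle_ineq4)
    also have "\<dots> \<le> \<bar>s\<bar> * (C * norm x) + \<bar>s\<bar> * (C * norm x)"
      using bound[of "s *\<^sub>R x"] mult_left_mono[OF bound[of x], of "\<bar>s\<bar>"]
      by (simp add: mult.left_commute)
    also have "\<dots> \<le> 2 * (C * norm x)"
    proof -
      have "\<bar>s\<bar> \<le> 1"
        using frac_lt_1[of "real n * r"] by (simp add: s_def)
      from mult_right_mono[OF this Cx] show ?thesis
        by (simp add: mult.left_commute)
    qed
    finally show ?thesis .
  qed
  then have "norm (h r) = 0"
    by (intro real_archimedian_rdiv_eq_0[of _ "2 * (C * norm x)"]) (use Cx in auto)
  then show "f (r *\<^sub>R x) = r *\<^sub>R f x"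
    by (simp add: h_def)
qed

section \<open>The \<open>\<ell>\<^sup>p\<close> norm\<close>

definition lp_norm :: "ereal \<Rightarrow> real \<times> real \<Rightarrow> real" where
  "lp_norm p u = lp_dist p 0 u"

lemma lp_dist_eq_lp_norm: "lp_dist p a b = lp_norm p (b - a)"
  by (simp add: lp_dist_def lp_norm_def)

lemma one_le_ereal_cases:
  assumes "1 \<le> p"
  obtains (real) s where "p = ereal s" "1 \<le> s" | (infinity) "p = \<infinity>"
  using assms by (cases p) auto

lemma lp_norm_real:
  "lp_norm (ereal s) u = (\<bar>fst u\<bar> powr s + \<bar>snd u\<bar> powr s) powr (1 / s)"
  by (simp add: lp_norm_def lp_dist_def)

lemma lp_norm_infinity: "lp_norm \<infinity> u = max \<bar>fst u\<bar> \<bar>snd u\<bar>"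
  by (simp add: lp_norm_def lp_dist_def)

lemma lp_norm_nonneg: "0 \<le> lp_norm p u"
  by (simp add: lp_norm_def lp_dist_def le_max_iff_disj)

lemma lp_norm_scaleR:
  assumes "1 \<le> p"
  shows "lp_norm p (r *\<^sub>R u) = \<bar>r\<bar> * lp_norm p u"
  using assms
proof (cases rule: one_le_ereal_cases)
  case (real s)
  then show ?thesis
    by (simp add: lp_norm_real abs_mult powr_mult powr_powr flip: distrib_left)
next
  case infinity
  then show ?thesis
    by (simp add: lp_norm_infinity abs_mult max_mult_distrib_left)
qed

lemma lp_norm_swap: "lp_norm p (y, x) = lp_norm p (x, y)"
  by (simp add: lp_norm_def lp_dist_def max.commute add.commute)

lemma lp_norm_axis:
  assumes "1 \<le> p"
  shows "lp_norm p (r, 0) = \<bar>r\<bar>" and "lp_norm p (0, r) = \<bar>r\<bar>"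
proof -
  have "lp_norm p (1, 0) = 1"
    using assms by (cases rule: one_le_ereal_cases) (simp_all add: lp_norm_real lp_norm_infinity)
  then show "lp_norm p (r, 0) = \<bar>r\<bar>"
    using lp_norm_scaleR[OF assms, of r "(1, 0)"] by simp
  then show "lp_norm p (0, r) = \<bar>r\<bar>"
    by (simp add: lp_norm_swap)
qed

lemma abs_fst_le_lp_norm:
  assumes "1 \<le> p"
  shows "\<bar>fst u\<bar> \<le> lp_norm p u"
  using assms
proof (cases rule: one_le_ereal_cases)
  case (real s)
  then have "\<bar>fst u\<bar> = (\<bar>fst u\<bar> powr s) powr (1 / s)"
    by (simp add: powr_powr)
  also have "\<dots> \<le> lp_norm p u"
    using real by (auto simp: lp_norm_real intro!: powr_mono2)
  finally show ?thesis .
qed (simp add: lp_norm_infinity)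

lemma abs_snd_le_lp_norm:
  assumes "1 \<le> p"
  shows "\<bar>snd u\<bar> \<le> lp_norm p u"
  using abs_fst_le_lp_norm[OF assms, of "(snd u, fst u)"] lp_norm_swap[of p "snd u" "fst u"] by simp

text \<open>
  The constants in this bound and in \<open>lp_norm_quasi_triangle\<close> are crude: both serve only to show that
  displacements under isometries and the images of bounded sets are bounded.
\<close>
lemma lp_norm_le:
  assumes "1 \<le> p"
  shows "lp_norm p u \<le> 2 * (\<bar>fst u\<bar> + \<bar>snd u\<bar>)"
  using assms
proof (cases rule: one_le_ereal_cases)
  case (real s)
  define M where "M = \<bar>fst u\<bar> + \<bar>snd u\<bar>"
  have "\<bar>fst u\<bar> powr s + \<bar>snd u\<bar> powr s \<le> M powr s + M powr s"
    unfolding M_def using real by (intro add_mono powr_mono2) auto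
  then have "lp_norm p u \<le> (2 * M powr s) powr (1 / s)"
    using real by (auto simp: lp_norm_real intro!: powr_mono2)
  also have "\<dots> = 2 powr (1 / s) * M"
    using real by (simp add: powr_mult powr_powr M_def)
  also have "\<dots> \<le> 2 powr 1 * M"
    using real by (intro mult_right_mono powr_mono) (auto simp: M_def)
  finally show ?thesis
    by (simp add: M_def)
qed (auto simp: lp_norm_infinity)

lemma lp_norm_eq_0_imp:
  assumes "1 \<le> p" "lp_norm p u = 0"
  shows "u = 0"
  using abs_fst_le_lp_norm[OF assms(1), of u] abs_snd_le_lp_norm[OF assms(1), of u] assms(2)
  by (simp add: prod_eq_iff)

lemma lp_norm_quasi_triangle:
  assumes "1 \<le> p"
  shows "lp_norm p (u + v) \<le> 4 * (lp_norm p u + lp_norm p v)"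
  using lp_norm_le[OF assms, of "u + v"] abs_fst_le_lp_norm[OF assms, of u]
    abs_fst_le_lp_norm[OF assms, of v] abs_snd_le_lp_norm[OF assms, of u]
    abs_snd_le_lp_norm[OF assms, of v] abs_triangle_ineq[of "fst u" "fst v"]
    abs_triangle_ineq[of "snd u" "snd v"]
  by simp

lemma lp_isometry_imp_linear:
  assumes "1 \<le> p" and iso: "isometry_of UNIV (lp_dist p) f" and "f 0 = 0"
  shows "linear f" and "lp_norm p (f u) = lp_norm p u"
proof -
  have "bij f" and diff: "lp_norm p (f x - f y) = lp_norm p (x - y)" for x y
    using iso unfolding isometry_of_def lp_dist_eq_lp_norm by blast+
  show norm_f: "lp_norm p (f u) = lp_norm p u" for u
    using diff[of u 0] \<open>f 0 = 0\<close> by simp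
  have "f (x + y) = f x + f y" for x y
    using quasinorm_isometry_preserves_midpoint[of "lp_norm p", OF lp_norm_scaleR[OF \<open>1 \<le> p\<close>]
        lp_norm_eq_0_imp[OF \<open>1 \<le> p\<close>] lp_norm_nonneg lp_norm_quasi_triangle[OF \<open>1 \<le> p\<close>]
        \<open>bij f\<close> diff] \<open>f 0 = 0\<close>
    by (rule midpoint_preserving_imp_additive)
  moreover have "norm (f u) \<le> 8 * norm u" for u
  proof -
    have "norm (f u) \<le> \<bar>fst (f u)\<bar> + \<bar>snd (f u)\<bar>"
      using norm_Pair_le[of "fst (f u)" "snd (f u)"] by simp
    also have "\<dots> \<le> 2 * lp_norm p u"
      using abs_fst_le_lp_norm[OF \<open>1 \<le> p\<close>, of "f u"] abs_snd_le_lp_norm[OF \<open>1 \<le> p\<close>, of "f u"]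
      by (simp add: norm_f)
    also have "\<dots> \<le> 8 * norm u"
      using lp_norm_le[OF \<open>1 \<le> p\<close>, of u] norm_fst_le[of "fst u" "snd u"]
        norm_snd_le[of "snd u" "fst u"] by simp
    finally show ?thesis .
  qed
  ultimately show "linear f"
    by (rule additive_norm_bounded_imp_linear)
qed

section \<open>Images of the basis vectors have disjoint supports\<close>

text \<open>
  The boundary values \<open>x = 0\<close> and \<open>y = 0\<close> are included, because in the application \<open>x\<close> and \<open>y\<close> are \<open>(a + b)\<^sup>2\<close> and \<open>(a - b)\<^sup>2\<close>, one of which may vanish.
\<close>
lemma powr_midpoint_convex:
  fixes x y q :: real
  assumes "1 \<le> q" "0 \<le> x" "0 \<le> y"
  shows "2 * ((x + y) / 2) powr q \<le> x powr q + y powr q"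
proof -
  have zero: "2 * (t / 2) powr q \<le> t powr q" if "0 \<le> t" for t :: real
  proof -
    have "(2::real) powr 1 \<le> 2 powr q"
      using assms by (intro powr_mono) auto
    then have "2 * (t powr q) \<le> 2 powr q * t powr q"
      by (intro mult_right_mono) auto
    then show ?thesis
      by (simp add: powr_divide field_simps)
  qed
  show ?thesis
  proof (cases "x = 0 \<or> y = 0")
    case True
    then show ?thesis
      using zero[OF assms(2)] zero[OF assms(3)] assms by auto
  next
    case False
    then have "((1 - 1/2) *\<^sub>R x + (1/2) *\<^sub>R y) powr q \<le> (1 - 1/2) * x powr q + (1/2) * y powr q"
      using assms by (intro convex_onD[OF powr_convex]) auto
    then show ?thesis
      by (simp add: add_divide_distrib)
  qed
qed

text \<open>This is \<open>powr_midpoint_convex\<close> for the exponent \<open>1 / q\<close>, applied to \<open>x powr q\<close> and \<open>y powr q\<close>.\<close>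
lemma powr_midpoint_concave:
  fixes x y q :: real
  assumes "0 < q" "q \<le> 1" "0 \<le> x" "0 \<le> y"
  shows "x powr q + y powr q \<le> 2 * ((x + y) / 2) powr q"
proof -
  have "2 * ((x powr q + y powr q) / 2) powr (1/q) \<le> (x powr q) powr (1/q) + (y powr q) powr (1/q)"
    using assms by (intro powr_midpoint_convex) auto
  then have "((x powr q + y powr q) / 2) powr (1/q) \<le> (x + y) / 2"
    using assms by (simp add: powr_powr)
  then have "(((x powr q + y powr q) / 2) powr (1/q)) powr q \<le> ((x + y) / 2) powr q"
    using assms by (intro powr_mono2) auto
  then show ?thesis
    using assms by (simp add: powr_powr)
qed

text \<open>
  After division by \<open>A + B\<close> this compares \<open>t powr q + (1 - t) powr q\<close> with \<open>t + (1 - t) = 1\<close> for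
  \<open>0 < t < 1\<close>, where raising the exponent lowers the power.
\<close>
lemma powr_add_strict:
  fixes A B q :: real
  assumes "0 < A" "0 < B"
  shows "1 < q \<Longrightarrow> A powr q + B powr q < (A + B) powr q"
    and "q < 1 \<Longrightarrow> (A + B) powr q < A powr q + B powr q"
proof -
  define t where "t = A / (A + B)"
  have t: "0 < t" "t < 1" and A: "A = t * (A + B)" and B: "B = (1 - t) * (A + B)"
    using assms by (auto simp: t_def field_simps)
  have eq: "A powr q + B powr q = (t powr q + (1 - t) powr q) * (A + B) powr q"
    by (subst A, subst B, simp only: powr_mult distrib_right)
  have pos: "0 < (A + B) powr q"
    using assms by simp
  {
    assume "1 < q"
    then have "t powr q + (1 - t) powr q < 1"
      using powr_less_mono'[of t 1 q] powr_less_mono'[of "1 - t" 1 q] t by simp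
    then show "A powr q + B powr q < (A + B) powr q"
      unfolding eq using pos by simp
  next
    assume "q < 1"
    then have "1 < t powr q + (1 - t) powr q"
      using powr_less_mono'[of t q 1] powr_less_mono'[of "1 - t" q 1] t by simp
    then show "(A + B) powr q < A powr q + B powr q"
      unfolding eq using pos by simp
  }
qed

lemma abs_powr_eq_square_powr: "\<bar>x\<bar> powr s = (x\<^sup>2) powr (s / 2)" for x s :: real
proof -
  have "\<bar>x\<bar> powr 2 = x\<^sup>2"
    by (cases "x = 0") simp_all
  then show ?thesis
    using powr_powr[of "\<bar>x\<bar>" 2 "s / 2"] by simp
qed

text \<open>
  Put \<open>q = s / 2\<close>. The squares \<open>(a + b)\<^sup>2\<close> and \<open>(a - b)\<^sup>2\<close> have mean \<open>a\<^sup>2 + b\<^sup>2\<close>, so convexity of the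
  \<open>q\<close>-th power bounds \<open>\<bar>a + b\<bar>\<^sup>s + \<bar>a - b\<bar>\<^sup>s\<close> below by \<open>2 (a\<^sup>2 + b\<^sup>2)\<^sup>q\<close>, and strict superadditivity bounds
  the latter below by \<open>2 (\<bar>a\<bar>\<^sup>s + \<bar>b\<bar>\<^sup>s)\<close>. For \<open>s < 2\<close> both steps reverse.
\<close>
lemma clarkson_strict:
  fixes a b s :: real
  assumes "a \<noteq> 0" "b \<noteq> 0"
  shows "2 < s \<Longrightarrow> 2 * (\<bar>a\<bar> powr s + \<bar>b\<bar> powr s) < \<bar>a + b\<bar> powr s + \<bar>a - b\<bar> powr s"
    and "0 < s \<Longrightarrow> s < 2 \<Longrightarrow> \<bar>a + b\<bar> powr s + \<bar>a - b\<bar> powr s < 2 * (\<bar>a\<bar> powr s + \<bar>b\<bar> powr s)"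
proof -
  have mean: "((a + b)\<^sup>2 + (a - b)\<^sup>2) / 2 = a\<^sup>2 + b\<^sup>2"
    by (simp add: power2_sum power2_diff)
  have pos: "0 < a\<^sup>2" "0 < b\<^sup>2"
    using assms by auto
  show "2 * (\<bar>a\<bar> powr s + \<bar>b\<bar> powr s) < \<bar>a + b\<bar> powr s + \<bar>a - b\<bar> powr s" if "2 < s"
    using powr_midpoint_convex[of "s/2" "(a + b)\<^sup>2" "(a - b)\<^sup>2"] powr_add_strict(1)[OF pos, of "s/2"]
      that by (simp add: mean abs_powr_eq_square_powr)
  show "\<bar>a + b\<bar> powr s + \<bar>a - b\<bar> powr s < 2 * (\<bar>a\<bar> powr s + \<bar>b\<bar> powr s)" if "0 < s" "s < 2"
    using powr_midpoint_concave[of "s/2" "(a + b)\<^sup>2" "(a - b)\<^sup>2"] powr_add_strict(2)[OF pos, of "s/2"]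
      that by (simp add: mean abs_powr_eq_square_powr)
qed

lemma clarkson_weak:
  fixes a b s :: real
  shows "2 < s \<Longrightarrow> 2 * (\<bar>a\<bar> powr s + \<bar>b\<bar> powr s) \<le> \<bar>a + b\<bar> powr s + \<bar>a - b\<bar> powr s"
    and "0 < s \<Longrightarrow> s < 2 \<Longrightarrow> \<bar>a + b\<bar> powr s + \<bar>a - b\<bar> powr s \<le> 2 * (\<bar>a\<bar> powr s + \<bar>b\<bar> powr s)"
  using clarkson_strict[of a b s] by (cases "a = 0"; cases "b = 0"; simp)+

text \<open>
  This is the equality case of Clarkson's inequality for the vectors \<open>(a, c)\<close> and \<open>(b, d)\<close> of the plane.
  The inequality holds in each coordinate, so equality of the sums forces it in each coordinate.
\<close>
lemma parallelogram_equality_imp_disjoint: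
  fixes a b c d s :: real
  assumes "0 < s" "s \<noteq> 2"
    and "(\<bar>a + b\<bar> powr s + \<bar>c + d\<bar> powr s) + (\<bar>a - b\<bar> powr s + \<bar>c - d\<bar> powr s) =
      2 * (\<bar>a\<bar> powr s + \<bar>c\<bar> powr s) + 2 * (\<bar>b\<bar> powr s + \<bar>d\<bar> powr s)"
  shows "a * b = 0 \<and> c * d = 0"
proof (rule ccontr)
  \<comment> \<open>The hypothesis groups the powers by vectors, the two-point inequality by coordinates.\<close>
  have eq: "(\<bar>a + b\<bar> powr s + \<bar>a - b\<bar> powr s) + (\<bar>c + d\<bar> powr s + \<bar>c - d\<bar> powr s) =
      2 * (\<bar>a\<bar> powr s + \<bar>b\<bar> powr s) + 2 * (\<bar>c\<bar> powr s + \<bar>d\<bar> powr s)"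
    using assms(3) by (simp only: distrib_left add_ac)
  assume "\<not> (a * b = 0 \<and> c * d = 0)"
  then have nz: "a \<noteq> 0 \<and> b \<noteq> 0 \<or> c \<noteq> 0 \<and> d \<noteq> 0"
    by simp
  show False
  proof (cases "2 < s")
    case True
    note weak = clarkson_weak(1)[OF True, of a b] clarkson_weak(1)[OF True, of c d]
    from nz show False
    proof (elim disjE conjE)
      assume "a \<noteq> 0" "b \<noteq> 0"
      from add_less_le_mono[OF clarkson_strict(1)[OF this True] weak(2)] show False
        by (simp only: eq less_irrefl)
    next
      assume "c \<noteq> 0" "d \<noteq> 0"
      from add_le_less_mono[OF weak(1) clarkson_strict(1)[OF this True]] show False
        by (simp only: eq less_irrefl)
    qed
  next
    case False
    then have "s < 2"
      using \<open>s \<noteq> 2\<close> by simp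
    note s = \<open>0 < s\<close> \<open>s < 2\<close>
    note weak = clarkson_weak(2)[OF s, of a b] clarkson_weak(2)[OF s, of c d]
    from nz show False
    proof (elim disjE conjE)
      assume "a \<noteq> 0" "b \<noteq> 0"
      from add_less_le_mono[OF clarkson_strict(2)[OF this s] weak(2)] show False
        by (simp only: eq less_irrefl)
    next
      assume "c \<noteq> 0" "d \<noteq> 0"
      from add_le_less_mono[OF weak(1) clarkson_strict(2)[OF this s]] show False
        by (simp only: eq less_irrefl)
    qed
  qed
qed

text \<open>
  For finite \<open>p\<close> both sides of the parallelogram identity for the \<open>p\<close>-th powers equal \<open>4\<close>. For
  \<open>p = \<infinity>\<close>, the sum and the difference have norm one, so \<open>\<bar>a\<bar> + \<bar>b\<bar> \<le> 1\<close> and \<open>\<bar>c\<bar> + \<bar>d\<bar> \<le> 1\<close>; each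
  vector has an entry of absolute value one, and the other vector then vanishes in that coordinate. So these two
  entries lie in different coordinates.
\<close>
lemma lp_norm_disjoint:
  assumes "1 \<le> p" "p \<noteq> 2"
    and "lp_norm p (a, c) = 1" "lp_norm p (b, d) = 1"
    and "lp_norm p (a + b, c + d) = lp_norm p (1, 1)"
    and "lp_norm p (a - b, c - d) = lp_norm p (1, 1)"
  shows "a * b = 0 \<and> c * d = 0"
  using assms(1)
proof (cases rule: one_le_ereal_cases)
  case (real s)
  then have "s \<noteq> 2"
    using \<open>p \<noteq> 2\<close> by auto
  have powr_norm: "lp_norm p u powr s = \<bar>fst u\<bar> powr s + \<bar>snd u\<bar> powr s" for u
    using real by (simp add: lp_norm_real powr_powr)
  show ?thesis
  proof (rule parallelogram_equality_imp_disjoint)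
    show "0 < s" "s \<noteq> 2"
      using real \<open>s \<noteq> 2\<close> by auto
    have "\<bar>a\<bar> powr s + \<bar>c\<bar> powr s = 1" "\<bar>b\<bar> powr s + \<bar>d\<bar> powr s = 1"
      using powr_norm[of "(a, c)"] powr_norm[of "(b, d)"] assms(3,4) by simp_all
    moreover have "\<bar>a + b\<bar> powr s + \<bar>c + d\<bar> powr s = 2" "\<bar>a - b\<bar> powr s + \<bar>c - d\<bar> powr s = 2"
      using powr_norm[of "(a + b, c + d)"] powr_norm[of "(a - b, c - d)"]
        powr_norm[of "(1, 1)"] assms(5,6) by simp_all
    ultimately show "(\<bar>a + b\<bar> powr s + \<bar>c + d\<bar> powr s) + (\<bar>a - b\<bar> powr s + \<bar>c - d\<bar> powr s) =
        2 * (\<bar>a\<bar> powr s + \<bar>c\<bar> powr s) + 2 * (\<bar>b\<bar> powr s + \<bar>d\<bar> powr s)"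
      by simp
  qed
next
  case infinity
  then have "\<bar>a + b\<bar> \<le> 1" "\<bar>a - b\<bar> \<le> 1" "\<bar>c + d\<bar> \<le> 1" "\<bar>c - d\<bar> \<le> 1"
    using assms(5,6) by (simp_all add: lp_norm_infinity max_def split: if_splits)
  then have "\<bar>a\<bar> + \<bar>b\<bar> \<le> 1" "\<bar>c\<bar> + \<bar>d\<bar> \<le> 1"
    by linarith+
  moreover have "\<bar>a\<bar> = 1 \<or> \<bar>c\<bar> = 1" "\<bar>b\<bar> = 1 \<or> \<bar>d\<bar> = 1"
    using infinity assms(3,4) by (simp_all add: lp_norm_infinity max_def split: if_splits)
  ultimately have "(a = 0 \<or> b = 0) \<and> (c = 0 \<or> d = 0)"
    by (elim disjE) simp_all
  then show ?thesis
    by simp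
qed

section \<open>The eight maps\<close>

lemma reflection_subspace:
  assumes "subspace L" "w \<in> L" and orth: "\<And>l. l \<in> L \<Longrightarrow> (z - w) \<bullet> l = 0"
  shows "reflection L z = 2 *\<^sub>R w - z"
proof -
  have "w = closest_point L z"
  proof (rule closest_point_unique)
    show "convex L" "closed L" "w \<in> L"
      using assms by (auto simp: subspace_imp_convex closed_subspace)
    show "\<forall>l\<in>L. dist z w \<le> dist z l"
    proof
      fix l assume "l \<in> L"
      then have "w - l \<in> L"
        using assms by (simp add: subspace_diff)
      then have "orthogonal (z - w) (w - l)"
        using orth by (simp add: orthogonal_def)
      then have "(norm (z - l))\<^sup>2 = (norm (z - w))\<^sup>2 + (norm (w - l))\<^sup>2"
        using norm_add_Pythagorean[of "z - w" "w - l"] by simp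
      then have "(norm (z - w))\<^sup>2 \<le> (norm (z - l))\<^sup>2"
        by simp
      then show "dist z w \<le> dist z l"
        unfolding dist_norm by (rule power2_le_imp_le) simp
    qed
  qed
  then show ?thesis
    by (simp add: reflection_def)
qed

lemma reflection_lines:
  "reflection {(x, y). x = 0} = (\<lambda>(x, y). (- x, y))"
  "reflection {(x, y). y = 0} = (\<lambda>(x, y). (x, - y))"
  "reflection {(x, y). y = x} = (\<lambda>(x, y). (y, x))"
  "reflection {(x, y). y = - x} = (\<lambda>(x, y). (- y, - x))"
proof -
  show "reflection {(x, y). x = 0} = (\<lambda>(x, y). (- x, y))"
  proof (intro ext, clarify)
    show "reflection {(x, y). x = 0} (x, y) = (- x, y)" for x y
      by (subst reflection_subspace[where w = "(0, y)"]) (auto simp: subspace_def zero_prod_def)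
  qed
  show "reflection {(x, y). y = 0} = (\<lambda>(x, y). (x, - y))"
  proof (intro ext, clarify)
    show "reflection {(x, y). y = 0} (x, y) = (x, - y)" for x y
      by (subst reflection_subspace[where w = "(x, 0)"]) (auto simp: subspace_def zero_prod_def)
  qed
  show "reflection {(x, y). y = x} = (\<lambda>(x, y). (y, x))"
  proof (intro ext, clarify)
    show "reflection {(x, y). y = x} (x, y) = (y, x)" for x y
      by (subst reflection_subspace[where w = "((x + y) / 2, (x + y) / 2)"])
        (auto simp: subspace_def zero_prod_def field_simps)
  qed
  show "reflection {(x, y). y = - x} = (\<lambda>(x, y). (- y, - x))"
  proof (intro ext, clarify)
    show "reflection {(x, y). y = - x} (x, y) = (- y, - x)" for x y
      by (subst reflection_subspace[where w = "((x - y) / 2, (y - x) / 2)"])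
        (auto simp: subspace_def zero_prod_def field_simps)
  qed
qed

lemma rotation_quarter_turns:
  "rotation (pi / 2) = (\<lambda>(x, y). (- y, x))"
  "rotation pi = (\<lambda>(x, y). (- x, - y))"
  "rotation (- (pi / 2)) = (\<lambda>(x, y). (y, - x))"
  by (auto simp: rotation_def)

text \<open>
  The symmetry group of the square, written in coordinates; the eight maps are in the order of the
  geometric descriptions in \<open>signed_permutations_eq\<close>.
\<close>
definition signed_permutations :: "(real \<times> real \<Rightarrow> real \<times> real) set" where
  "signed_permutations =
    {\<lambda>(x, y). (x, y), \<lambda>(x, y). (- x, y), \<lambda>(x, y). (x, - y), \<lambda>(x, y). (y, x),
     \<lambda>(x, y). (- y, - x), \<lambda>(x, y). (- y, x), \<lambda>(x, y). (- x, - y), \<lambda>(x, y). (y, - x)}"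

lemma signed_permutations_eq:
  "signed_permutations =
    {id, reflection {(x, y). x = 0}, reflection {(x, y). y = 0}, reflection {(x, y). y = x},
     reflection {(x, y). y = - x}, rotation (pi / 2), rotation pi, rotation (- (pi / 2))}"
  unfolding signed_permutations_def reflection_lines rotation_quarter_turns
  by (simp add: id_def case_prod_unfold)

lemma card_signed_permutations: "card signed_permutations = 8"
proof -
  \<comment> \<open>The point \<open>(1, 2)\<close> lies on none of the four mirror lines, so its eight images are distinct.\<close>
  have "inj_on (\<lambda>\<phi>. \<phi> (1, 2)) signed_permutations"
    by (auto simp: signed_permutations_def inj_on_def)
  then have "card signed_permutations = card ((\<lambda>\<phi>. \<phi> (1, 2)) ` signed_permutations)"
    by (simp add: card_image)
  then show ?thesis
    by (simp add: signed_permutations_def)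
qed

lemma signed_permutation_isometry:
  assumes "\<phi> \<in> signed_permutations"
  shows "isometry_of UNIV (lp_dist p) \<phi>" and "\<phi> 0 = 0"
proof -
  \<comment> \<open>The order of each element of the group divides four, so the cube is an inverse.\<close>
  have "\<phi> \<circ> \<phi> \<circ> \<phi> \<circ> \<phi> = id"
    using assms by (auto simp: signed_permutations_def)
  then have "bij \<phi>"
    by (metis comp_assoc o_bij)
  moreover have "lp_dist p (\<phi> a) (\<phi> b) = lp_dist p a b" for a b
    using assms
    by (auto simp: signed_permutations_def lp_dist_def case_prod_unfold abs_minus_commute
        max.commute add.commute)
  ultimately show "isometry_of UNIV (lp_dist p) \<phi>"
    by (simp add: isometry_of_def)
  show "\<phi> 0 = 0"
    using assms by (auto simp: signed_permutations_def zero_prod_def)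
qed

text \<open>
  Once the columns \<open>(a, c)\<close> and \<open>(b, d)\<close> of the matrix of \<open>f\<close> have disjoint supports, neither can have
  two nonzero entries: the other column would be zero, but it has norm one.
\<close>
lemma lp_isometry_imp_signed_permutation:
  assumes "1 \<le> p" "p \<noteq> 2" and iso: "isometry_of UNIV (lp_dist p) f" and "f 0 = 0"
  shows "f \<in> signed_permutations"
proof -
  note lin = lp_isometry_imp_linear(1)[OF assms(1,3,4)]
    and norm_f = lp_isometry_imp_linear(2)[OF assms(1,3,4)]
  obtain a c b d where e1: "f (1, 0) = (a, c)" and e2: "f (0, 1) = (b, d)"
    by fastforce
  have f: "f (x, y) = (x * a + y * b, x * c + y * d)" for x y
  proof -
    have "f (x, y) = f (x *\<^sub>R (1, 0) + y *\<^sub>R (0, 1))"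
      by simp
    also have "\<dots> = x *\<^sub>R f (1, 0) + y *\<^sub>R f (0, 1)"
      by (simp only: linear_add[OF lin] linear_scale[OF lin])
    finally show ?thesis
      by (simp add: e1 e2)
  qed
  note axis = lp_norm_axis[OF \<open>1 \<le> p\<close>]
  have u: "lp_norm p (a, c) = 1" and v: "lp_norm p (b, d) = 1"
    using norm_f[of "(1, 0)"] norm_f[of "(0, 1)"] by (simp_all add: e1 e2 axis)
  have "lp_norm p (1, -1) = lp_norm p (1, 1)"
    by (simp add: lp_norm_def lp_dist_def)
  then have "a * b = 0 \<and> c * d = 0"
    using norm_f[of "(1, 1)"] norm_f[of "(1, -1)"]
    by (intro lp_norm_disjoint[OF assms(1,2) u v]) (simp_all add: f)
  then have "\<bar>a\<bar> = 1 \<and> c = 0 \<and> b = 0 \<and> \<bar>d\<bar> = 1 \<or> a = 0 \<and> \<bar>c\<bar> = 1 \<and> \<bar>b\<bar> = 1 \<and> d = 0"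
    using u v by (cases "a = 0"; cases "c = 0"; force simp: axis)
  then have "(a = 1 \<or> a = -1) \<and> c = 0 \<and> b = 0 \<and> (d = 1 \<or> d = -1) \<or>
      a = 0 \<and> (c = 1 \<or> c = -1) \<and> (b = 1 \<or> b = -1) \<and> d = 0"
    by linarith
  moreover have "f = (\<lambda>(x, y). (x * a + y * b, x * c + y * d))"
    using f by auto
  ultimately show ?thesis
    by (elim disjE conjE) (simp_all add: signed_permutations_def)
qed

theorem theorem5p5:
  fixes p :: ereal
  assumes "1 \<le> p" and "p \<noteq> 2"
  shows "card {\<phi>. isometry_of UNIV (lp_dist p) \<phi> \<and> \<phi> (0, 0) = (0, 0)} = 8 \<and>
    {\<phi>. isometry_of UNIV (lp_dist p) \<phi> \<and> \<phi> (0, 0) = (0, 0)} =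
      {id,
       reflection {(x, y). x = 0},
       reflection {(x, y). y = 0},
       reflection {(x, y). y = x},
       reflection {(x, y). y = - x},
       rotation (pi / 2),
       rotation pi,
       rotation (- (pi / 2))}"
proof -
  have "{\<phi>. isometry_of UNIV (lp_dist p) \<phi> \<and> \<phi> (0, 0) = (0, 0)} = signed_permutations"
    using lp_isometry_imp_signed_permutation[OF assms] signed_permutation_isometry
    by (auto simp: zero_prod_def)
  then show ?thesis
    using card_signed_permutations unfolding signed_permutations_eq by simp
qed

end
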